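(* Let $\alpha\in(1/(n+1),1)$ and let $((X_1,Y_1),\dots,(X_{n+1},Y_{n+1}))\in(\mathbb{R}^k\times\mathbb{R}^\ell)^{n+1}$ be exchangeable pairs of random vectors. With $q_{n,\alpha}$, $\widehat{\boldsymbol\Sigma}_{n,\lambda}$, $\overline X_n$, $\overline R_n$ as defined in the context, define $\mathcal E_\alpha^n$ as follows. If $q_{n,\alpha}\ge n-1$, set $\mathcal E_\alpha^n=\mathbb{R}^\ell$. If $q_{n,\alpha}<n-1$, set $$\mathcal E_\alpha^n=\{z\in\mathbb{R}^\ell:\ (z-Z_0^n)^\top\boldsymbol{\mathcal A}_n^{-1}(z-Z_0^n)\le\rho_{n,\alpha}\},$$ where, with $X_{n+1}^{\mathrm c}=X_{n+1}-\overline X_n$, $$\boldsymbol{\mathcal A}_n=\widehat{\boldsymbol\Sigma}_{n,\lambda}/\widehat{\boldsymbol\Sigma}_{n,\lambda}^{11},\qquad Z_0^n=\widehat{\boldsymbol\Sigma}_n^{21}(\widehat{\boldsymbol\Sigma}_{n,\lambda}^{11})^{-1}X_{n+1}^{\mathrm c}+\overline R_n,$$ $$\rho_{n,\alpha}=\frac{q_{n,\alpha}+1}{1-(q_{n,\alpha}+1)/n}-1-(X_{n+1}^{\mathrm c})^\top(\widehat{\boldsymbol\Sigma}_{n,\lambda}^{11})^{-1}X_{n+1}^{\mathrm c}.$$ Then $$\mathbb{P}(Y_{n+1}-\widehat Y_{n+1}\in\mathcal E_\alpha^n)\ge1-\alpha.$$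
   Context: $k,\ell\ge1$, $p=k+\ell$; $\lambda>0$ is a fixed ridge parameter; $\widehat f:\mathbb{R}^k\to\mathbb{R}^\ell$ is a fixed deterministic measurable predictor. $\widehat Y_i=\widehat f(X_i)$, $R_i=Y_i-\widehat Y_i$, $V_i=(X_i^\top\ R_i^\top)^\top\in\mathbb{R}^p$. $\overline X_n=\frac1n\sum_{i=1}^nX_i$, $\overline R_n=\frac1n\sum_{i=1}^nR_i$, $\overline V_n=\frac1n\sum_{i=1}^nV_i$. $\mathbf B_n$ is the $n\times p$ matrix with $i$-th row $(V_i-\overline V_n)^\top$, and $$\widehat{\boldsymbol\Sigma}_{n,\lambda}=\tfrac1n\mathbf B_n^\top\mathbf B_n+\lambda\mathbf I_p=\begin{pmatrix}\widehat{\boldsymbol\Sigma}_{n,\lambda}^{11}&\widehat{\boldsymbol\Sigma}_n^{12}\\ \widehat{\boldsymbol\Sigma}_n^{21}&\widehat{\boldsymbol\Sigma}_{n,\lambda}^{22}\end{pmatrix}$$ in blocks according to $p=k+\ell$. $\mathbf P_{n,\lambda}=\mathbf B_n(\mathbf B_n^\top\mathbf B_n+n\lambda\mathbf I_p)^{-1}\mathbf B_n^\top$, $p_{i,n}=(\mathbf P_{n,\lambda})_{ii}$. $n_\alpha=\lceil(1-\alpha)(n+1)\rceil$, and $q_{n,\alpha}=n\,p_{(n_\alpha)}$ where $p_{(n_\alpha)}$ is the $n_\alpha$-th smallest of $(p_{1,n},\dots,p_{n,n})$. For a block matrix $\mathbf M=\begin{pmatrix}\mathbf A&\mathbf B\\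 \mathbf C&\mathbf D\end{pmatrix}$, $\mathbf M/\mathbf A=\mathbf D-\mathbf C\mathbf A^{-1}\mathbf B$ is the Schur complement. *)

theory Defs
  imports "HOL-Probability.Probability" "HOL-Library.Multiset"
begin

text \<open>
  The dimensions \<open>k\<close>, \<open>\<ell>\<close> and the sample size \<open>n\<close> are the cardinalities of the finite types \<open>'k\<close>, \<open>'l\<close>
  and \<open>'n\<close>; vectors of length \<open>p = k + \<ell>\<close> are indexed by \<open>'k + 'l\<close>.  The \<open>n + 1\<close> observations are
  indexed by \<open>'n option\<close>: \<open>Some i\<close> ranges over the first \<open>n\<close> of them and \<open>None\<close> is the last one.
\<close>

definition exchangeable ::
    "'w measure \<Rightarrow> ('i::finite \<Rightarrow> 'w \<Rightarrow> 'b::topological_space) \<Rightarrow> bool" where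
  "exchangeable M Z \<longleftrightarrow>
     (\<forall>\<pi>. bij \<pi> \<longrightarrow>
        distr M (\<Pi>\<^sub>M i\<in>UNIV. borel) (\<lambda>\<omega> i. Z (\<pi> i) \<omega>) =
        distr M (\<Pi>\<^sub>M i\<in>UNIV. borel) (\<lambda>\<omega> i. Z i \<omega>))"

definition stack :: "real^'k::finite \<Rightarrow> real^'l::finite \<Rightarrow> real^('k + 'l)" where
  "stack x r = (\<chi> s. case s of Inl a \<Rightarrow> x $ a | Inr b \<Rightarrow> r $ b)"

definition sample_mean :: "('n::finite \<Rightarrow> 'b::real_vector) \<Rightarrow> 'b" where
  "sample_mean v = (1 / real CARD('n)) *\<^sub>R (\<Sum>i\<in>UNIV. v i)"

definition block11 :: "real^('k::finite + 'l::finite)^('k + 'l) \<Rightarrow> real^'k^'k" where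
  "block11 S = (\<chi> i j. S $ Inl i $ Inl j)"

definition block12 :: "real^('k::finite + 'l::finite)^('k + 'l) \<Rightarrow> real^'l^'k" where
  "block12 S = (\<chi> i j. S $ Inl i $ Inr j)"

definition block21 :: "real^('k::finite + 'l::finite)^('k + 'l) \<Rightarrow> real^'k^'l" where
  "block21 S = (\<chi> i j. S $ Inr i $ Inl j)"

definition block22 :: "real^('k::finite + 'l::finite)^('k + 'l) \<Rightarrow> real^'l^'l" where
  "block22 S = (\<chi> i j. S $ Inr i $ Inr j)"

definition schur_complement ::
    "real^('k::finite + 'l::finite)^('k + 'l) \<Rightarrow> real^'l^'l" where
  "schur_complement S = block22 S - block21 S ** matrix_inv (block11 S) ** block12 S"

text \<open>
  Below, \<open>x\<close> and \<open>r\<close> are the covariates \<open>X_1, \<dots>, X_n\<close> and residuals \<open>R_1, \<dots>, R_n\<close>, and \<open>x'\<close> is the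
  new covariate \<open>X_{n+1}\<close>.  For \<open>lam > 0\<close> every matrix passed to \<^const>\<open>matrix_inv\<close> is positive definite.
\<close>

definition centered_matrix ::
    "('n::finite \<Rightarrow> real^'k::finite) \<Rightarrow> ('n \<Rightarrow> real^'l::finite) \<Rightarrow> real^('k + 'l)^'n" where
  "centered_matrix x r = (\<chi> i. stack (x i) (r i) - sample_mean (\<lambda>j. stack (x j) (r j)))"

definition ridge_cov ::
    "real \<Rightarrow> ('n::finite \<Rightarrow> real^'k::finite) \<Rightarrow> ('n \<Rightarrow> real^'l::finite)
      \<Rightarrow> real^('k + 'l)^('k + 'l)" where
  "ridge_cov lam x r =
     (1 / real CARD('n)) *\<^sub>R (transpose (centered_matrix x r) ** centered_matrix x r)
     + lam *\<^sub>R mat 1"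

definition ridge_hat ::
    "real \<Rightarrow> ('n::finite \<Rightarrow> real^'k::finite) \<Rightarrow> ('n \<Rightarrow> real^'l::finite) \<Rightarrow> real^'n^'n" where
  "ridge_hat lam x r =
     centered_matrix x r
     ** matrix_inv (transpose (centered_matrix x r) ** centered_matrix x r
                    + (real CARD('n) * lam) *\<^sub>R mat 1)
     ** transpose (centered_matrix x r)"

text \<open>The \<open>m\<close>-th smallest value of a finite family, counted from 1 and with multiplicity;
  meaningful for \<open>1 \<le> m \<le> CARD('n)\<close>.\<close>

definition order_statistic :: "nat \<Rightarrow> ('n::finite \<Rightarrow> real) \<Rightarrow> real" where
  "order_statistic m v = sorted_list_of_multiset (image_mset v (mset_set UNIV)) ! (m - 1)"

definition quantile ::
    "real \<Rightarrow> real \<Rightarrow> ('n::finite \<Rightarrow> real^'k::finite) \<Rightarrow> ('n \<Rightarrow> real^'l::finite) \<Rightarrow> real" where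
  "quantile lam \<alpha> x r =
     real CARD('n)
     * order_statistic (nat \<lceil>(1 - \<alpha>) * (real CARD('n) + 1)\<rceil>) (\<lambda>i. ridge_hat lam x r $ i $ i)"

definition center ::
    "real \<Rightarrow> ('n::finite \<Rightarrow> real^'k::finite) \<Rightarrow> ('n \<Rightarrow> real^'l::finite) \<Rightarrow> real^'k \<Rightarrow> real^'l" where
  "center lam x r x' =
     block21 (ridge_cov lam x r)
       *v (matrix_inv (block11 (ridge_cov lam x r)) *v (x' - sample_mean x))
     + sample_mean r"

definition radius ::
    "real \<Rightarrow> real \<Rightarrow> ('n::finite \<Rightarrow> real^'k::finite) \<Rightarrow> ('n \<Rightarrow> real^'l::finite) \<Rightarrow> real^'k \<Rightarrow> real" where
  "radius lam \<alpha> x r x' =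
     (quantile lam \<alpha> x r + 1) / (1 - (quantile lam \<alpha> x r + 1) / real CARD('n)) - 1
     - (x' - sample_mean x)
       \<bullet> (matrix_inv (block11 (ridge_cov lam x r)) *v (x' - sample_mean x))"

definition prediction_set ::
    "real \<Rightarrow> real \<Rightarrow> ('n::finite \<Rightarrow> real^'k::finite) \<Rightarrow> ('n \<Rightarrow> real^'l::finite) \<Rightarrow> real^'k
      \<Rightarrow> (real^'l) set" where
  "prediction_set lam \<alpha> x r x' =
     (if quantile lam \<alpha> x r \<ge> real CARD('n) - 1 then UNIV
      else {z. (z - center lam x r x')
                 \<bullet> (matrix_inv (schur_complement (ridge_cov lam x r)) *v (z - center lam x r x'))
               \<le> radius lam \<alpha> x r x'})"

end

theory Submission
  imports Defs
begin

text \<open>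
  The proof is a conformal argument applied to a score that the prediction set never mentions. Write
  \<open>V\<^sub>i\<close> for the stacked vectors of covariate and residual, \<open>n\<close> for the number of old points and
  \<open>c = n \<lambda>\<close>, and let \<open>s\<^sub>i\<close> be the ridge leverage of \<open>V\<^sub>i\<close> in the full sample of \<open>n + 1\<close> points, with
  the penalty \<open>c\<close>. Leverages are permuted along with the sample (\<open>leverage_permute\<close>), so by
  exchangeability fewer than \<open>m\<close> of the \<open>s\<^sub>i\<close> are strictly below \<open>s\<^sub>n\<^sub>+\<^sub>1\<close> with probability at least
  \<open>m / (n + 1)\<close> (\<open>exchangeable_small_rank\<close>). For \<open>m = \<lceil>(1 - \<alpha>) (n + 1)\<rceil>\<close> this is at least \<open>1 - \<alpha>\<close>.

  It remains to see that this event is contained in the event of coverage. With the same penalty,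
  the scatter matrix of the full sample is a rank-one update of that of the first \<open>n\<close> points, and the
  Sherman--Morrison formula has two consequences. The score \<open>s\<^sub>n\<^sub>+\<^sub>1\<close> is an explicit increasing function of
  the Mahalanobis distance from \<open>V\<^sub>n\<^sub>+\<^sub>1\<close> to the first \<open>n\<close> points (\<open>leverage_new\<close>), and each old score
  exceeds the leverage \<open>p\<^sub>i\<close> of the same point in the first sample by at most \<open>1 / (n (n + 1))\<close>, whatever
  the new point is (\<open>leverage_old_le\<close>). Hence a small rank of \<open>s\<^sub>n\<^sub>+\<^sub>1\<close> forces it below the \<open>m\<close>-th smallest
  \<open>p\<^sub>i\<close> plus that constant (\<open>leverage_new_le_order_statistic\<close>). Solving for the Mahalanobis distance
  gives exactly the threshold in the definition of the prediction set (\<open>score_le_threshold\<close>), and block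
  elimination identifies the ellipsoid given by the Schur complement with the corresponding slice of a
  Mahalanobis ball (\<open>prediction_set_iff\<close>).
\<close>

section \<open>Inverses of matrices with trivial kernel\<close>

lemma matrix_inv_solves:
  fixes A :: "real^'m^'m"
  assumes "\<And>y. A *v y = 0 \<Longrightarrow> y = 0"
  shows "A *v (matrix_inv A *v b) = b"
proof -
  have "invertible A"
    using assms matrix_left_invertible_ker[of A] by (auto simp: invertible_left_inverse)
  then have "A ** matrix_inv A = mat 1" 
    unfolding invertible_def matrix_inv_def by (rule someI2_ex) blast
  then show ?thesis by (simp add: matrix_vector_mul_assoc)
qed

lemma matrix_inv_eqI:
  fixes A :: "real^'m^'m"
  assumes "\<And>y. A *v y = 0 \<Longrightarrow> y = 0" and "A *v y = b"
  shows "matrix_inv A *v b = y"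
proof -
  have "A *v (matrix_inv A *v b - y) = 0"
    using matrix_inv_solves[of A b, OF assms(1)] assms(2) by (simp add: matrix_vector_mult_diff_distrib)
  from assms(1)[OF this] show ?thesis by simp
qed

definition inv_form :: "real^'p^'p \<Rightarrow> real^'p \<Rightarrow> real" where
  "inv_form A u = u \<bullet> (matrix_inv A *v u)"

lemma inv_form_scaleR:
  fixes G :: "real^'p^'p"
  assumes ker: "\<And>y. G *v y = 0 \<Longrightarrow> y = 0" and "k \<noteq> 0"
  shows "inv_form (k *\<^sub>R G) u = inv_form G u / k"
proof -
  have mult: "(k *\<^sub>R G) *v y = k *\<^sub>R (G *v y)" for y by (simp add: scaleR_matrix_vector_assoc)
  have "matrix_inv (k *\<^sub>R G) *v u = (1 / k) *\<^sub>R (matrix_inv G *v u)"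
  proof (rule matrix_inv_eqI)
    show "y = 0" if "(k *\<^sub>R G) *v y = 0" for y using that assms unfolding mult by simp
    show "(k *\<^sub>R G) *v ((1 / k) *\<^sub>R (matrix_inv G *v u)) = u"
      using matrix_inv_solves[of G u, OF ker] \<open>k \<noteq> 0\<close>
      unfolding mult by (simp add: matrix_vector_mult_scaleR)
  qed
  then show ?thesis by (simp add: inv_form_def)
qed

text \<open>
  The Sherman--Morrison formula, evaluated on a vector shifted along the direction of the update:
  this is the shape in which recentring at the new mean produces it.
\<close>
lemma inv_form_rank_one:
  fixes G H :: "real^'p^'p"
  assumes G: "\<And>y. G *v y = 0 \<Longrightarrow> y = 0" and H: "\<And>y. H *v y = 0 \<Longrightarrow> y = 0"
    and sym: "\<And>x y. x \<bullet> (G *v y) = y \<bullet> (G *v x)"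
    and upd: "\<And>y. H *v y = G *v y + (c * (u \<bullet> y)) *\<^sub>R u"
    and pos: "1 + c * inv_form G u \<noteq> 0"
  shows "inv_form H (w + g *\<^sub>R u) =
    inv_form G w + (g^2 * inv_form G u + 2 * g * (w \<bullet> (matrix_inv G *v u))
      - c * (w \<bullet> (matrix_inv G *v u))^2) / (1 + c * inv_form G u)"
proof -
  define yw where "yw = matrix_inv G *v w"
  define yu where "yu = matrix_inv G *v u"
  define b where "b = w \<bullet> yu"
  define d where "d = u \<bullet> yu"
  \<comment> \<open>The solution of \<open>H y = w + g u\<close> is sought as \<open>yw + e yu\<close>; comparing the coefficients of \<open>u\<close>
    leaves one linear equation for \<open>e\<close>.\<close>
  define e where "e = (g - c * b) / (1 + c * d)"
  have Gw: "G *v yw = w" and Gu: "G *v yu = u"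
    unfolding yw_def yu_def by (simp_all add: matrix_inv_solves G)
  have b': "u \<bullet> yw = b"
    using sym[of yw yu] unfolding Gw Gu b_def by (simp add: inner_commute)
  have pos': "1 + c * d \<noteq> 0" using pos unfolding d_def yu_def inv_form_def .
  have e: "e + c * (b + e * d) = g"
  proof -
    have "e * (1 + c * d) = g - c * b" using pos' unfolding e_def by simp
    then show ?thesis by (simp add: algebra_simps)
  qed
  have "H *v (yw + e *\<^sub>R yu) = w + g *\<^sub>R u"
  proof -
    have "H *v (yw + e *\<^sub>R yu) = w + e *\<^sub>R u + (c * (b + e * d)) *\<^sub>R u"
      unfolding upd by (simp add: matrix_vector_right_distrib matrix_vector_mult_scaleR Gw Gu inner_add_right b' d_def)
    also have "\<dots> = w + (e + c * (b + e * d)) *\<^sub>R u" by (simp add: algebra_simps)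
    finally show ?thesis by (simp add: e)
  qed
  from matrix_inv_eqI[OF _ this] have "matrix_inv H *v (w + g *\<^sub>R u) = yw + e *\<^sub>R yu"
    using H by blast
  then have "inv_form H (w + g *\<^sub>R u) = w \<bullet> yw + e * b + g * b + g * e * d"
    by (simp add: inv_form_def inner_add_left inner_add_right b' b_def d_def algebra_simps)
  also have "\<dots> = w \<bullet> yw + (g^2 * d + 2 * g * b - c * b^2) / (1 + c * d)"
  proof -
    have "e * b + g * b + g * e * d = e * (b + g * d) + g * b * (1 + c * d) / (1 + c * d)"
      unfolding nonzero_mult_div_cancel_right[OF pos'] by (simp add: algebra_simps)
    also have "\<dots> = ((g - c * b) * (b + g * d) + g * b * (1 + c * d)) / (1 + c * d)"
      unfolding e_def by (simp only: add_divide_distrib times_divide_eq_left)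
    also have "(g - c * b) * (b + g * d) + g * b * (1 + c * d) = g^2 * d + 2 * g * b - c * b^2"
      by (simp add: algebra_simps power2_eq_square)
    finally show ?thesis by simp
  qed
  finally show ?thesis unfolding inv_form_def yw_def b_def d_def yu_def .
qed

section \<open>Ridge scatter matrices\<close>

text \<open>
  The scatter matrix about the sample mean with the ridge penalty \<open>c\<close> added; it is an unnormalised
  covariance, so that the penalty stays the same when a point is added to the sample.
\<close>
definition ridge_scatter :: "real \<Rightarrow> ('i::finite \<Rightarrow> real^'p) \<Rightarrow> real^'p^'p" where
  "ridge_scatter c v =
     (\<chi> a b. \<Sum>i\<in>UNIV. (v i - sample_mean v) $ a * (v i - sample_mean v) $ b) + c *\<^sub>R mat 1"

lemma ridge_scatter_mult_vec:
  "ridge_scatter c v *v y =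
     (\<Sum>i\<in>UNIV. ((v i - sample_mean v) \<bullet> y) *\<^sub>R (v i - sample_mean v)) + c *\<^sub>R y"
proof -
  define w where "w i = v i - sample_mean v" for i
  have "((\<chi> a b. \<Sum>i\<in>UNIV. w i $ a * w i $ b) *v y) $ a = (\<Sum>i\<in>UNIV. (w i \<bullet> y) *\<^sub>R w i) $ a" for a
  proof -
    have "((\<chi> a b. \<Sum>i\<in>UNIV. w i $ a * w i $ b) *v y) $ a
      = (\<Sum>b\<in>UNIV. \<Sum>i\<in>UNIV. w i $ a * w i $ b * y $ b)"
      by (simp add: matrix_vector_mult_def sum_distrib_right)
    also have "\<dots> = (\<Sum>i\<in>UNIV. \<Sum>b\<in>UNIV. w i $ a * w i $ b * y $ b)" by (rule sum.swap)
    also have "\<dots> = (\<Sum>i\<in>UNIV. (w i \<bullet> y) *\<^sub>R w i) $ a"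
      by (simp add: inner_vec_def sum_distrib_left sum_distrib_right mult_ac)
    finally show ?thesis .
  qed
  then have "(\<chi> a b. \<Sum>i\<in>UNIV. w i $ a * w i $ b) *v y = (\<Sum>i\<in>UNIV. (w i \<bullet> y) *\<^sub>R w i)"
    by (simp add: vec_eq_iff)
  moreover have "(c *\<^sub>R mat 1 :: real^_^_) *v y = c *\<^sub>R y"
    by (simp flip: scaleR_matrix_vector_assoc)
  ultimately show ?thesis
    unfolding ridge_scatter_def w_def by (simp add: matrix_vector_mult_add_rdistrib)
qed

lemma ridge_scatter_inner:
  "x \<bullet> (ridge_scatter c v *v y) =
     (\<Sum>i\<in>UNIV. ((v i - sample_mean v) \<bullet> y) * (x \<bullet> (v i - sample_mean v))) + c * (x \<bullet> y)"
  by (simp add: ridge_scatter_mult_vec inner_add_right inner_sum_right)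

lemma ridge_scatter_sym: "x \<bullet> (ridge_scatter c v *v y) = y \<bullet> (ridge_scatter c v *v x)"
  unfolding ridge_scatter_inner by (simp add: inner_commute mult.commute)

lemma ridge_scatter_ge: "c * (y \<bullet> y) \<le> y \<bullet> (ridge_scatter c v *v y)"
  unfolding ridge_scatter_inner by (simp add: inner_commute sum_nonneg)

text \<open>
  The matrix is therefore invertible, so that \<open>matrix_inv\<close> returns a true inverse: the quadratic form of the matrix is at least
  \<open>c\<close> times the squared norm.
\<close>
lemma ridge_scatter_ker:
  assumes "c > 0" "ridge_scatter c v *v y = 0"
  shows "y = 0"
proof -
  have "y \<bullet> y \<le> 0" using ridge_scatter_ge[of c y v] assms by (simp add: mult_le_0_iff)
  then show ?thesis using inner_gt_zero_iff[of y] by linarith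
qed

lemma inv_form_nonneg:
  assumes "c > 0"
  shows "inv_form (ridge_scatter c v) u \<ge> 0"
proof -
  define y where "y = matrix_inv (ridge_scatter c v) *v u"
  have "ridge_scatter c v *v y = u"
    unfolding y_def by (rule matrix_inv_solves) (rule ridge_scatter_ker[OF assms])
  then have "inv_form (ridge_scatter c v) u = y \<bullet> (ridge_scatter c v *v y)"
    by (simp add: inv_form_def y_def inner_commute)
  also have "\<dots> \<ge> c * (y \<bullet> y)" by (rule ridge_scatter_ge)
  moreover have "c * (y \<bullet> y) \<ge> 0" using assms by simp
  ultimately show ?thesis by linarith
qed

lemma sum_centered:
  fixes v :: "'n::finite \<Rightarrow> 'b::real_vector"
  shows "(\<Sum>i\<in>UNIV. v i - sample_mean v) = 0"
  by (simp add: sum_subtractf sample_mean_def scaleR_conv_of_real[symmetric] sum_constant_scaleR)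

lemma UNIV_option_sum:
  fixes f :: "'n::finite option \<Rightarrow> 'b::comm_monoid_add"
  shows "(\<Sum>i\<in>UNIV. f i) = f None + (\<Sum>i\<in>UNIV. f (Some i))"
  by (simp add: UNIV_option_conv sum.reindex)

lemma sample_mean_option:
  fixes v :: "'n::finite option \<Rightarrow> 'b::real_vector"
  defines "m \<equiv> sample_mean (\<lambda>i. v (Some i))"
  shows "sample_mean v = m + (1 / (real CARD('n) + 1)) *\<^sub>R (v None - m)"
proof -
  define n where "n = real CARD('n)"
  have n: "n > 0" unfolding n_def by simp
  have "(\<Sum>i\<in>UNIV. v (Some i)) = n *\<^sub>R m" using n unfolding m_def sample_mean_def n_def by simp
  moreover have "real CARD('n option) = n + 1"
    unfolding n_def by (simp add: card_UNIV_option)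
  ultimately have "sample_mean v = (1 / (n+1)) *\<^sub>R (v None + n *\<^sub>R m)"
    unfolding sample_mean_def[of v] by (simp add: UNIV_option_sum)
  also have "\<dots> = m + (1 / (n + 1)) *\<^sub>R (v None - m)"
  proof -
    have k: "n / (n + 1) = 1 - 1 / (n + 1)" using n by (simp add: field_simps)
    have "(1 / (n + 1)) *\<^sub>R (v None + n *\<^sub>R m) = (1 / (n + 1)) *\<^sub>R v None + (n / (n + 1)) *\<^sub>R m"
      by (simp add: scaleR_add_right)
    then show ?thesis unfolding k by (simp add: scaleR_diff_left scaleR_diff_right)
  qed
  finally show ?thesis unfolding n_def .
qed

text \<open>
  Adding one point moves the mean by \<open>u / (n + 1)\<close>. The \<open>n\<close> recentred old points contribute
  \<open>n / (n + 1)\<^sup>2\<close> and the new point \<open>n\<^sup>2 / (n + 1)\<^sup>2\<close> to the coefficient of \<open>u u\<^sup>T\<close>, which add up to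
  \<open>n / (n + 1)\<close>.
\<close>
lemma ridge_scatter_option:
  fixes v :: "'n::finite option \<Rightarrow> real^'p"
  defines "u \<equiv> v None - sample_mean (\<lambda>i. v (Some i))"
  defines "n \<equiv> real CARD('n)"
  shows "ridge_scatter c v *v y
    = ridge_scatter c (\<lambda>i. v (Some i)) *v y + (n / (n + 1) * (u \<bullet> y)) *\<^sub>R u"
proof -
  define m where "m = sample_mean (\<lambda>i. v (Some i))"
  define w where "w i = v (Some i) - m" for i
  have n: "n > 0" unfolding n_def by simp
  define t where "t = 1 / (n + 1)"
  have sm: "sample_mean v = m + t *\<^sub>R u"
    unfolding m_def u_def n_def t_def by (rule sample_mean_option)
  have wN: "v None - sample_mean v = (1 - t) *\<^sub>R u"
    unfolding sm by (simp add: u_def m_def algebra_simps)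
  have wS: "v (Some i) - sample_mean v = w i - t *\<^sub>R u" for i
    unfolding sm by (simp add: w_def)
  have w0: "(\<Sum>i\<in>UNIV. w i) = 0" unfolding w_def m_def by (rule sum_centered)
  then have w0': "(\<Sum>i\<in>UNIV. w i \<bullet> y) = 0" by (simp flip: inner_sum_left)
  \<comment> \<open>Old points are recentred by \<open>- t u\<close>; the cross terms vanish because the \<open>w i\<close> sum to zero.\<close>
  have "(\<Sum>i\<in>UNIV. ((v i - sample_mean v) \<bullet> y) *\<^sub>R (v i - sample_mean v))
      = ((1 - t)^2 * (u \<bullet> y)) *\<^sub>R u + (\<Sum>i\<in>UNIV. ((w i - t *\<^sub>R u) \<bullet> y) *\<^sub>R (w i - t *\<^sub>R u))"
    by (simp add: UNIV_option_sum wN wS power2_eq_square mult_ac)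
  also have "(\<Sum>i\<in>UNIV. ((w i - t *\<^sub>R u) \<bullet> y) *\<^sub>R (w i - t *\<^sub>R u))
     = (\<Sum>i\<in>UNIV. (w i \<bullet> y) *\<^sub>R w i - (t * (w i \<bullet> y)) *\<^sub>R u - (t * (u \<bullet> y)) *\<^sub>R w i + (t^2 * (u \<bullet> y)) *\<^sub>R u)"
    by (simp add: inner_diff_left algebra_simps power2_eq_square)
  also have "\<dots> = (\<Sum>i\<in>UNIV. (w i \<bullet> y) *\<^sub>R w i) + (n * (t^2 * (u \<bullet> y))) *\<^sub>R u"
    by (simp add: sum.distrib sum_subtractf w0 w0' n_def sum_constant_scaleR del: sum_constant
        flip: scaleR_sum_left scaleR_sum_right sum_distrib_left)
  finally have "(\<Sum>i\<in>UNIV. ((v i - sample_mean v) \<bullet> y) *\<^sub>R (v i - sample_mean v))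
     = (\<Sum>i\<in>UNIV. (w i \<bullet> y) *\<^sub>R w i) + (((1-t)^2 + n * t^2) * (u \<bullet> y)) *\<^sub>R u"
    by (simp add: algebra_simps)
  also have "(1-t)^2 + n * t^2 = n / (n+1)"
  proof -
    have t1: "t * (n + 1) = 1" using n by (simp add: t_def)
    then have m: "1 - t = n * t" by (simp add: algebra_simps)
    have "(1-t)^2 + n * t^2 = n * t * (t * (n + 1))"
      unfolding m by (simp add: power2_eq_square algebra_simps)
    then show ?thesis unfolding t1 by (simp add: t_def)
  qed
  finally show ?thesis
    unfolding ridge_scatter_mult_vec w_def m_def by simp
qed

section \<open>Leverages and the effect of one more point\<close>

definition leverage :: "real \<Rightarrow> ('i::finite \<Rightarrow> real^'p) \<Rightarrow> 'i \<Rightarrow> real" where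
  "leverage c v i = inv_form (ridge_scatter c v) (v i - sample_mean v)"

lemma leverage_permute:
  fixes v :: "'i::finite \<Rightarrow> real^'p"
    and \<pi> :: "'i \<Rightarrow> 'i"
  assumes "bij \<pi>"
  shows "leverage c (\<lambda>i. v (\<pi> i)) j = leverage c v (\<pi> j)"
proof -
  have r: "(\<Sum>i\<in>UNIV. f (\<pi> i)) = (\<Sum>i\<in>UNIV. f i)" for f :: "'i \<Rightarrow> 'c::comm_monoid_add"
    using sum.reindex_bij_betw[OF assms, of f] by simp
  have "sample_mean (\<lambda>i. v (\<pi> i)) = sample_mean v" unfolding sample_mean_def by (simp add: r)
  moreover have "ridge_scatter c (\<lambda>i. v (\<pi> i)) = ridge_scatter c v"
    unfolding ridge_scatter_def calculation
    by (simp only: r[of "\<lambda>i. (v i - sample_mean v) $ a * (v i - sample_mean v) $ b" for a b])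
  ultimately show ?thesis unfolding leverage_def by simp
qed

text \<open>
  The leverage of the new point is an increasing function of its squared ridge Mahalanobis distance
  \<open>\<delta>\<close> to the old points, so a bound on the former is one on the latter.
\<close>
lemma leverage_new:
  fixes v :: "'n::finite option \<Rightarrow> real^'p" and c :: real
  defines "n \<equiv> real CARD('n)"
  defines "\<delta> \<equiv> inv_form (ridge_scatter c (\<lambda>i. v (Some i))) (v None - sample_mean (\<lambda>i. v (Some i)))"
  assumes "c > 0"
  shows "leverage c v None = (n / (n + 1))^2 * \<delta> / (1 + n / (n + 1) * \<delta>)"
proof -
  define u where "u = v None - sample_mean (\<lambda>i. v (Some i))"
  have n: "n > 0" unfolding n_def by simp
  have d: "\<delta> \<ge> 0" unfolding \<delta>_def by (rule inv_form_nonneg[OF assms(3)])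
  have "v None - sample_mean v = 0 + (n / (n+1)) *\<^sub>R u"
  proof -
    have "n / (n + 1) = 1 - 1 / (n + 1)" using n by (simp add: field_simps)
    then show ?thesis unfolding sample_mean_option u_def n_def
      by (simp add: scaleR_diff_left)
  qed
  moreover have "inv_form (ridge_scatter c v) (0 + (n / (n+1)) *\<^sub>R u)
    = inv_form (ridge_scatter c (\<lambda>i. v (Some i))) 0 + ((n/(n+1))^2 * inv_form (ridge_scatter c (\<lambda>i. v (Some i))) u
       + 2 * (n/(n+1)) * (0 \<bullet> (matrix_inv (ridge_scatter c (\<lambda>i. v (Some i))) *v u)) - n / (n+1) * (0 \<bullet> (matrix_inv (ridge_scatter c (\<lambda>i. v (Some i))) *v u))^2)
       / (1 + n / (n+1) * inv_form (ridge_scatter c (\<lambda>i. v (Some i))) u)"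
  proof (rule inv_form_rank_one)
    show "1 + n / (n + 1) * inv_form (ridge_scatter c (\<lambda>i. v (Some i))) u \<noteq> 0"
      using d n unfolding \<delta>_def u_def by (simp add: add_nonneg_eq_0_iff)
  qed (fact ridge_scatter_sym | erule ridge_scatter_ker[OF assms(3)]
      | simp add: ridge_scatter_option u_def n_def)+
  ultimately show ?thesis
    unfolding leverage_def \<delta>_def u_def by (simp add: inv_form_def)
qed

text \<open>
  Leverages of old points depend on the new point, which at prediction time is unknown. This bound is
  uniform in the new point and lets the leverages of the first \<open>n\<close> points stand in for those of the
  full sample.
\<close>
lemma leverage_old_le:
  fixes v :: "'n::finite option \<Rightarrow> real^'p" and c :: real
  defines "n \<equiv> real CARD('n)"
  assumes "c > 0"
  shows "leverage c v (Some i) \<le> leverage c (\<lambda>i. v (Some i)) i + 1 / (n * (n + 1))"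
proof -
  define G where "G = ridge_scatter c (\<lambda>i. v (Some i))"
  define u where "u = v None - sample_mean (\<lambda>i. v (Some i))"
  define w where "w = v (Some i) - sample_mean (\<lambda>i. v (Some i))"
  define d where "d = inv_form G u"
  define b where "b = w \<bullet> (matrix_inv G *v u)"
  define k where "k = n / (n + 1)"
  define g where "g = - (1 / (n + 1))"
  have n: "n > 0" unfolding n_def by simp
  have k: "k > 0" using n unfolding k_def by simp
  have d: "d \<ge> 0" unfolding d_def G_def by (rule inv_form_nonneg[OF assms(2)])
  have gk: "g = - k / n" using n unfolding g_def k_def by simp
  have "v (Some i) - sample_mean v = w + g *\<^sub>R u"
    unfolding sample_mean_option u_def n_def w_def g_def by (simp add: algebra_simps)
  moreover have "inv_form (ridge_scatter c v) (w + g *\<^sub>R u)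
    = inv_form G w + (g^2 * inv_form G u + 2 * g * (w \<bullet> (matrix_inv G *v u)) - k * (w \<bullet> (matrix_inv G *v u))^2) / (1 + k * inv_form G u)"
    unfolding G_def
  proof (rule inv_form_rank_one)
    show "1 + k * inv_form (ridge_scatter c (\<lambda>i. v (Some i))) u \<noteq> 0"
      using d k unfolding d_def G_def by (simp add: add_nonneg_eq_0_iff)
  qed (fact ridge_scatter_sym | erule ridge_scatter_ker[OF assms(2)]
      | simp add: ridge_scatter_option u_def n_def k_def)+
  ultimately have "leverage c v (Some i) = inv_form G w + (g^2 * d + 2 * g * b - k * b^2) / (1 + k * d)"
    unfolding leverage_def b_def d_def by simp
  then have 1: "leverage c v (Some i)
      = leverage c (\<lambda>i. v (Some i)) i + (g^2 * d + 2 * g * b - k * b^2) / (1 + k * d)"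
    unfolding leverage_def w_def G_def .
  \<comment> \<open>A concave quadratic in \<open>b\<close>, maximal at \<open>b = - 1 / n\<close>; the factor \<open>1 + k * d\<close> of its maximum
    cancels against the denominator, so that the bound depends on \<open>n\<close> alone.\<close>
  have "g^2 * d + 2 * g * b - k * b^2 = k / n^2 * (1 + k * d) - k * (b + 1 / n)^2"
    using n unfolding gk by (simp add: field_simps power2_eq_square)
  also have "\<dots> \<le> k / n^2 * (1 + k * d)" using k by simp
  finally have "(g^2 * d + 2 * g * b - k * b^2) / (1 + k * d) \<le> k / n^2"
    using k d by (simp add: divide_le_eq add_pos_nonneg)
  also have "k / n^2 = 1 / (n * (n+1))" using n unfolding k_def by (simp add: power2_eq_square)
  finally show ?thesis unfolding 1 by simp
qed

section \<open>Block elimination and the shape of the prediction set\<close>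

lemma sum_UNIV_sum_type:
  fixes f :: "'a::finite + 'b::finite \<Rightarrow> 'c::comm_monoid_add"
  shows "(\<Sum>s\<in>UNIV. f s) = (\<Sum>a\<in>UNIV. f (Inl a)) + (\<Sum>b\<in>UNIV. f (Inr b))"
  using sum.Plus[of UNIV UNIV f] by (simp add: UNIV_Plus_UNIV)

lemma inner_stack: "stack x z \<bullet> stack x' z' = x \<bullet> x' + z \<bullet> z'"
  by (simp add: inner_vec_def stack_def sum_UNIV_sum_type)

lemma matrix_mult_stack:
  "S *v stack x z =
     stack (block11 S *v x + block12 S *v z) (block21 S *v x + block22 S *v z)"
  by (simp add: vec_eq_iff matrix_vector_mult_def stack_def sum_UNIV_sum_type block11_def
      block12_def block21_def block22_def split: sum.split)

lemma stack_eq_iff: "stack x z = stack x' z' \<longleftrightarrow> x = x' \<and> z = z'"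
  by (auto simp: vec_eq_iff stack_def split: sum.splits)

lemma stack_zero: "stack 0 0 = 0"
  by (auto simp: vec_eq_iff stack_def split: sum.split)

lemma stack_diff: "stack x z - stack x' z' = stack (x - x') (z - z')"
  by (auto simp: vec_eq_iff stack_def split: sum.split)

lemma sample_mean_stack:
  "sample_mean (\<lambda>i. stack (x i) (r i)) = stack (sample_mean x) (sample_mean r)"
  by (auto simp: vec_eq_iff stack_def sample_mean_def split: sum.split)

text \<open>
  Squared Mahalanobis distance splits into that of the first block and that of the residual of the regression
  of the second block on the first, measured by the Schur complement. The assumption \<open>pd\<close> is positive
  definiteness in contraposed form.
\<close>
lemma inv_form_block:
  fixes S :: "real^('k::finite + 'l::finite)^('k + 'l)"
  assumes pd: "\<And>y. y \<bullet> (S *v y) \<le> 0 \<Longrightarrow> y = 0"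
    and sym: "\<And>x y. x \<bullet> (S *v y) = y \<bullet> (S *v x)"
  shows "inv_form S (stack x z) = inv_form (block11 S) x
    + inv_form (schur_complement S) (z - block21 S *v (matrix_inv (block11 S) *v x))"
proof -
  let ?A = "block11 S" and ?B = "block12 S" and ?C = "block21 S"
  have ker: "y = 0" if "S *v y = 0" for y using pd[of y] that by simp
  have kerA: "y = 0" if "?A *v y = 0" for y
  proof -
    have "stack y 0 = (0 :: real^('k + 'l))"
      by (rule pd) (simp add: matrix_mult_stack inner_stack that)
    then show ?thesis by (simp flip: stack_zero add: stack_eq_iff)
  qed
  note A_inv = matrix_inv_solves[of ?A, OF kerA]
  have symA: "y \<bullet> (?A *v y') = y' \<bullet> (?A *v y)" for y y'
    using sym[of "stack y 0" "stack y' 0"] by (simp add: matrix_mult_stack inner_stack)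
  have symB: "y \<bullet> (?B *v z) = z \<bullet> (?C *v y)" for y z
    using sym[of "stack y 0" "stack 0 z"] by (simp add: matrix_mult_stack inner_stack)
  have schur: "schur_complement S *v y = block22 S *v y - ?C *v (matrix_inv ?A *v (?B *v y))" for y
    by (simp add: schur_complement_def matrix_vector_mult_diff_rdistrib matrix_vector_mul_assoc
        matrix_mul_assoc)
  have kerSchur: "y = 0" if "schur_complement S *v y = 0" for y
  proof -
    have "stack (- (matrix_inv ?A *v (?B *v y))) y = (0 :: real^('k + 'l))"
    proof (rule ker)
      have neg: "N *v (- a) = - (N *v a)" for N :: "real^'b^'c" and a
        using matrix_vector_mult_diff_distrib[of N 0 a] by simp
      show "S *v stack (- (matrix_inv ?A *v (?B *v y))) y = 0"
        using that unfolding schur by (simp add: matrix_mult_stack neg A_inv stack_zero)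
    qed
    then show ?thesis by (simp flip: stack_zero add: stack_eq_iff)
  qed
  \<comment> \<open>Block elimination: \<open>y2\<close> solves the Schur complement system, and back substitution gives \<open>y1\<close>.\<close>
  define a where "a = matrix_inv ?A *v x"
  define e where "e = z - ?C *v a"
  define y2 where "y2 = matrix_inv (schur_complement S) *v e"
  define y1 where "y1 = a - matrix_inv ?A *v (?B *v y2)"
  have y2: "schur_complement S *v y2 = e"
    unfolding y2_def by (rule matrix_inv_solves) (rule kerSchur)
  have a: "?A *v a = x" unfolding a_def by (rule A_inv)
  have "S *v stack y1 y2 = stack x z"
    using y2 by (simp add: matrix_mult_stack stack_eq_iff y1_def matrix_vector_mult_diff_distrib A_inv a schur e_def algebra_simps)
  from matrix_inv_eqI[of S, OF ker this]
  have "inv_form S (stack x z) = x \<bullet> y1 + z \<bullet> y2" by (simp add: inv_form_def inner_stack)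
  also have "x \<bullet> y1 = x \<bullet> a - a \<bullet> (?B *v y2)"
    using symA[of "matrix_inv ?A *v (?B *v y2)" a] 
    by (simp add: y1_def inner_diff_right a A_inv inner_commute)
  also have "a \<bullet> (?B *v y2) = (?C *v a) \<bullet> y2" by (simp add: symB inner_commute)
  also have "x \<bullet> a - (?C *v a) \<bullet> y2 + z \<bullet> y2 = x \<bullet> a + e \<bullet> y2"
    by (simp add: e_def inner_diff_left)
  finally show ?thesis unfolding inv_form_def y2_def e_def a_def .
qed

lemma gram_centered_matrix:
  "transpose (centered_matrix x r) ** centered_matrix x r + c *\<^sub>R mat 1
     = ridge_scatter c (\<lambda>i. stack (x i) (r i))"
  by (simp add: ridge_scatter_def centered_matrix_def matrix_matrix_mult_def transpose_def vec_eq_iff)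

lemma ridge_hat_diag:
  fixes x :: "'n::finite \<Rightarrow> real^'k::finite" and r :: "'n \<Rightarrow> real^'l::finite"
  shows "ridge_hat lam x r $ i $ i = leverage (real CARD('n) * lam) (\<lambda>i. stack (x i) (r i)) i"
proof -
  have diag: "(B ** N ** transpose B) $ i $ i = B $ i \<bullet> (N *v B $ i)" for B :: "real^'p^'n" and N
    by (simp add: matrix_matrix_mult_def transpose_def inner_vec_def matrix_vector_mult_def
        sum_distrib_left sum_distrib_right mult_ac) (subst sum.swap, simp add: mult_ac)
  show ?thesis
    unfolding ridge_hat_def gram_centered_matrix leverage_def inv_form_def diag
    by (simp add: centered_matrix_def)
qed

lemma ridge_cov_eq:
  fixes x :: "'n::finite \<Rightarrow> real^'k::finite" and r :: "'n \<Rightarrow> real^'l::finite"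
  shows "ridge_cov lam x r
    = (1 / real CARD('n)) *\<^sub>R ridge_scatter (real CARD('n) * lam) (\<lambda>i. stack (x i) (r i))"
  unfolding ridge_cov_def gram_centered_matrix[symmetric] by (simp add: scaleR_add_right)

text \<open>
  The ellipsoid around the regression centre is the slice at \<open>x'\<close> of a Mahalanobis ball in the joint
  space: by the block formula, the term subtracted in the radius is the contribution of \<open>x'\<close> alone.
  The factor \<open>n\<close> turns the inverse of the scatter matrix into that of the covariance matrix.
\<close>
lemma prediction_set_iff:
  fixes x :: "'n::finite \<Rightarrow> real^'k::finite" and r :: "'n \<Rightarrow> real^'l::finite"
  defines "n \<equiv> real CARD('n)" and "V \<equiv> \<lambda>i. stack (x i) (r i)"
  assumes "lam > 0"
  shows "z \<in> prediction_set lam \<alpha> x r x' \<longleftrightarrow>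
    quantile lam \<alpha> x r \<ge> n - 1 \<or>
    n * inv_form (ridge_scatter (n * lam) V) (stack x' z - sample_mean V)
      \<le> (quantile lam \<alpha> x r + 1) / (1 - (quantile lam \<alpha> x r + 1) / n) - 1"
proof -
  define S where "S = ridge_cov lam x r"
  define G where "G = ridge_scatter (n * lam) V"
  have n: "n > 0" and c: "n * lam > 0" using \<open>lam > 0\<close> unfolding n_def by simp_all
  have S: "S = (1 / n) *\<^sub>R G" unfolding S_def G_def n_def V_def by (rule ridge_cov_eq)
  have Sv: "S *v y = (1 / n) *\<^sub>R (G *v y)" for y by (simp add: S scaleR_matrix_vector_assoc)
  have pd: "y = 0" if "y \<bullet> (S *v y) \<le> 0" for y
  proof -
    have "y \<bullet> (G *v y) \<le> 0" using that n by (simp add: Sv divide_le_0_iff)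
    with ridge_scatter_ge[of "n * lam" y V] have "(n * lam) * (y \<bullet> y) \<le> 0" unfolding G_def by linarith
    then have "y \<bullet> y \<le> 0" using mult_le_cancel_left_pos[OF c, of "y \<bullet> y" 0] by simp
    then show ?thesis using inner_gt_zero_iff[of y] by linarith
  qed
  have sym: "y \<bullet> (S *v y') = y' \<bullet> (S *v y)" for y y'
    by (simp add: Sv G_def ridge_scatter_sym[of y])
  have "stack x' z - sample_mean V = stack (x' - sample_mean x) (z - sample_mean r)"
    unfolding V_def sample_mean_stack stack_diff ..
  moreover have "inv_form S u = n * inv_form G u" for u
  proof -
    have "inv_form S u = inv_form G u / (1 / n)"
      unfolding S by (rule inv_form_scaleR) (use ridge_scatter_ker[OF c] n in \<open>auto simp: G_def\<close>)
    then show ?thesis by simp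
  qed
  ultimately have "n * inv_form G (stack x' z - sample_mean V)
    = inv_form (block11 S) (x' - sample_mean x) + inv_form (schur_complement S) (z - center lam x r x')"
    using inv_form_block[of S, OF pd sym] by (simp add: center_def S_def diff_diff_add add.commute)
  then show ?thesis
    unfolding prediction_set_def radius_def inv_form_def G_def S_def n_def by auto
qed

section \<open>Ranks and order statistics\<close>

text \<open>
  In this form the order statistic is a matter of counting, which serves both for the coverage
  argument and for measurability.
\<close>
lemma order_statistic_le_iff:
  fixes v :: "'n::finite \<Rightarrow> real"
  assumes "1 \<le> m" "m \<le> CARD('n)"
  shows "order_statistic m v \<le> t \<longleftrightarrow> m \<le> card {i. v i \<le> t}"
proof -
  define xs where "xs = sorted_list_of_multiset (image_mset v (mset_set UNIV))"
  have srt: "sorted xs" unfolding xs_def by simp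
  have mset: "mset xs = image_mset v (mset_set UNIV)" unfolding xs_def by simp
  then have len: "length xs = CARD('n)"
    by (metis size_mset size_image_mset size_mset_set)
  have "card {i. v i \<le> t} = size (filter_mset (\<lambda>y. y \<le> t) (mset xs))"
    unfolding mset by (simp add: filter_mset_image_mset)
  also have "\<dots> = length (filter (\<lambda>y. y \<le> t) xs)" by (metis mset_filter size_mset)
  also have "\<dots> = card {i. i < length xs \<and> xs ! i \<le> t}" by (rule length_filter_conv_card)
  finally have c: "card {i. v i \<le> t} = card {i. i < length xs \<and> xs ! i \<le> t}" .
  show ?thesis
  proof
    assume "order_statistic m v \<le> t"
    then have "xs ! (m - 1) \<le> t" unfolding order_statistic_def xs_def .
    then have "{..<m} \<subseteq> {i. i < length xs \<and> xs ! i \<le> t}"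
    proof (intro subsetI CollectI conjI)
      fix i assume "i \<in> {..<m}"
      then have i: "i \<le> m - 1" "m - 1 < length xs" using assms len by auto
      then show "i < length xs" by simp
      show "xs ! i \<le> t" using sorted_nth_mono[OF srt i] \<open>xs ! (m - 1) \<le> t\<close> by simp
    qed
    from card_mono[OF _ this] show "m \<le> card {i. v i \<le> t}" unfolding c by simp
  next
    assume *: "m \<le> card {i. v i \<le> t}"
    show "order_statistic m v \<le> t"
    proof (rule ccontr)
      assume "\<not> order_statistic m v \<le> t"
      then have "xs ! (m - 1) > t" unfolding order_statistic_def xs_def by simp
      then have "{i. i < length xs \<and> xs ! i \<le> t} \<subseteq> {..<m - 1}"
        using sorted_nth_mono[OF srt, of "m - 1"] by (force simp: not_le[symmetric])
      from card_mono[OF _ this] show False using * assms unfolding c by simp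
    qed
  qed
qed

text \<open>
  There is equality if the values are distinct. Ties can only lower a rank, because it counts the strictly
  smaller values.
\<close>
lemma card_small_rank:
  fixes s :: "'i::finite \<Rightarrow> 'a::linorder"
  assumes "m \<le> CARD('i)"
  shows "m \<le> card {j. card {i. s i < s j} < m}"
proof (cases "\<exists>j. m \<le> card {i. s i < s j}")
  case False
  then have "{j. card {i. s i < s j} < m} = UNIV" by (auto simp: not_le)
  then show ?thesis using assms by simp
next
  case True
  define B where "B = {j. m \<le> card {i. s i < s j}}"
  have B: "finite B" "B \<noteq> {}" using True by (auto simp: B_def)
  \<comment> \<open>Everything strictly below a minimal element of the complement has small rank, and there are
    at least \<open>m\<close> such indices.\<close>
  define j where "j = arg_min_on s B"
  have j: "j \<in> B" "\<And>i. i \<in> B \<Longrightarrow> s j \<le> s i"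
    unfolding j_def using arg_min_if_finite(1)[OF B] arg_min_least[OF B] by auto
  then have "{i. s i < s j} \<subseteq> {j. card {i. s i < s j} < m}"
    unfolding B_def by (auto simp: not_le[symmetric])
  then have "card {i. s i < s j} \<le> card {j. card {i. s i < s j} < m}"
    by (intro card_mono) auto
  then show ?thesis using j(1) unfolding B_def by simp
qed

text \<open>
  If the new leverage exceeded the bound, then by \<open>leverage_old_le\<close> the at least \<open>m\<close> old points
  whose leverage in the first sample is at most the order statistic would all lie strictly below it in the
  full sample, contradicting its rank.
\<close>
lemma leverage_new_le_order_statistic:
  fixes v :: "'n::finite option \<Rightarrow> real^'p"
  defines "n \<equiv> real CARD('n)"
  assumes "c > 0" "1 \<le> m" "m \<le> CARD('n)"
    and rank: "card {i. leverage c v i < leverage c v None} < m"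
  shows "leverage c v None
    \<le> order_statistic m (leverage c (\<lambda>i. v (Some i))) + 1 / (n * (n + 1))"
proof (rule ccontr)
  define p where "p = leverage c (\<lambda>i. v (Some i))"
  define t where "t = order_statistic m p"
  assume "\<not> ?thesis"
  then have *: "t + 1 / (n * (n + 1)) < leverage c v None" unfolding t_def p_def by simp
  have "m \<le> card {i. p i \<le> t}"
    using order_statistic_le_iff[OF assms(3,4), of p t] unfolding t_def by simp
  also have "\<dots> = card (Some ` {i. p i \<le> t})" by (simp add: card_image)
  also have "\<dots> \<le> card {i. leverage c v i < leverage c v None}"
  proof (rule card_mono)
    have "leverage c v (Some i) < leverage c v None" if "p i \<le> t" for i
      using leverage_old_le[OF assms(2), of v i] that * unfolding p_def n_def by linarith
    then show "Some ` {i. p i \<le> t} \<subseteq> {i. leverage c v i < leverage c v None}" by auto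
  qed simp
  finally show False using rank by simp
qed

text \<open>
  Solving the bound on the leverage for the Mahalanobis distance. The bound that this gives for
  \<open>n * \<delta>\<close> is \<open>((n + 1) q + 1) / (n - 1 - q)\<close>, which is the threshold written differently. The
  condition \<open>q < n - 1\<close> keeps the leverage bound below \<open>n / (n + 1)\<close>, the supremum of the possible
  values; from there on it would no longer constrain \<open>\<delta>\<close>.
\<close>
lemma score_le_threshold:
  fixes n q \<delta> :: real
  assumes "n > 0" "\<delta> \<ge> 0" "q < n - 1"
    and "(n / (n + 1))^2 * \<delta> / (1 + n / (n + 1) * \<delta>) \<le> q / n + 1 / (n * (n + 1))"
  shows "n * \<delta> \<le> (q + 1) / (1 - (q + 1) / n) - 1"
proof -
  define a where "a = (n + 1) * q + 1"
  have rhs: "q / n + 1 / (n * (n + 1)) = a / (n * (n + 1))"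
    using assms(1) by (simp add: a_def add_divide_distrib)
  have "1 + n / (n + 1) * \<delta> = (n + 1 + n * \<delta>) / (n + 1)"
    using assms(1) by (simp add: field_simps)
  moreover have "n + 1 + n * \<delta> > 0" using assms(1,2) by (simp add: add_pos_nonneg)
  ultimately have "n^2 * \<delta> / ((n + 1) * (n + 1 + n * \<delta>)) \<le> a / (n * (n + 1))"
    using assms(1,4) unfolding rhs by (simp add: power_divide power2_eq_square)
  then have "n^2 * \<delta> * (n * (n + 1)) \<le> a * ((n + 1) * (n + 1 + n * \<delta>))"
  proof -
    assume *: "n^2 * \<delta> / ((n + 1) * (n + 1 + n * \<delta>)) \<le> a / (n * (n + 1))"
    have "(n + 1) * (n + 1 + n * \<delta>) > 0" "n * (n + 1) > 0"
      using assms(1) \<open>n + 1 + n * \<delta> > 0\<close> by simp_all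
    with * show ?thesis
      by (simp only: pos_divide_le_eq times_divide_eq_left pos_le_divide_eq)
  qed
  then have "(n + 1) * (n^2 * \<delta> * n) \<le> (n + 1) * (a * (n + 1 + n * \<delta>))"
    by (simp only: mult_ac)
  then have "n^2 * \<delta> * n \<le> a * (n + 1 + n * \<delta>)"
    using assms(1) by (simp only: mult_le_cancel_left_pos)
  then have "(n + 1) * (n * \<delta> * (n - 1 - q)) \<le> (n + 1) * a"
    by (simp add: a_def algebra_simps power2_eq_square)
  then have "n * \<delta> * (n - 1 - q) \<le> a"
    using assms(1) by (simp only: mult_le_cancel_left_pos)
  then have "n * \<delta> \<le> a / (n - 1 - q)" using assms(3) by (simp add: pos_le_divide_eq)
  also have "a / (n - 1 - q) = (q + 1) / (1 - (q + 1) / n) - 1"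
  proof -
    have "1 - (q + 1) / n = (n - 1 - q) / n" using assms(1) by (simp add: field_simps)
    then have "(q + 1) / (1 - (q + 1) / n) - 1 = (q + 1) * n / (n - 1 - q) - 1" by simp
    also have "\<dots> = ((q + 1) * n - (n - 1 - q)) / (n - 1 - q)"
      using assms(3) by (simp add: diff_divide_distrib)
    finally show ?thesis by (simp add: a_def algebra_simps)
  qed
  finally show ?thesis .
qed

section \<open>Measurability\<close>

lemma borel_measurable_vecI:
  fixes f :: "'a \<Rightarrow> 'b::euclidean_space ^ 'n"
  assumes "\<And>i. (\<lambda>\<omega>. f \<omega> $ i) \<in> borel_measurable M"
  shows "f \<in> borel_measurable M"
  using assms by (subst borel_measurable_euclidean_space) (auto simp: Basis_vec_def inner_axis)

lemma borel_measurable_vec_nth [measurable (raw)]: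
  fixes f :: "'a \<Rightarrow> 'b::euclidean_space ^ 'n"
  assumes "f \<in> borel_measurable M"
  shows "(\<lambda>\<omega>. f \<omega> $ i) \<in> borel_measurable M"
  by (rule measurable_compose[OF assms borel_measurable_continuous_onI]) (intro continuous_intros)

lemma borel_measurable_det:
  fixes A :: "'a \<Rightarrow> real^'m^'m"
  assumes "A \<in> borel_measurable M"
  shows "(\<lambda>\<omega>. det (A \<omega>)) \<in> borel_measurable M"
  using assms unfolding det_def
  by (intro borel_measurable_sum borel_measurable_times borel_measurable_prod borel_measurable_const
      borel_measurable_vec_nth)

text \<open>
  Cramer's rule exhibits the solution of the linear system as a quotient of determinants, hence of
  polynomials in the entries.
\<close>
lemma borel_measurable_inv_form:
  fixes A :: "'a \<Rightarrow> real^'m^'m"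
  assumes [measurable]: "A \<in> borel_measurable M" "u \<in> borel_measurable M"
    and ker: "\<And>\<omega> y. A \<omega> *v y = 0 \<Longrightarrow> y = 0"
  shows "(\<lambda>\<omega>. inv_form (A \<omega>) (u \<omega>)) \<in> borel_measurable M"
proof -
  have "matrix_inv (A \<omega>) *v u \<omega> = (\<chi> k. det (\<chi> i j. if j = k then u \<omega> $ i else A \<omega> $ i $ j) / det (A \<omega>))" for \<omega>
  proof -
    have "det (A \<omega>) \<noteq> 0"
      using ker[of \<omega>] matrix_left_invertible_ker[of "A \<omega>"]
      by (auto simp: invertible_left_inverse simp flip: invertible_det_nz)
    have "A \<omega> *v (matrix_inv (A \<omega>) *v u \<omega>) = u \<omega>"
      by (rule matrix_inv_solves) (rule ker)
    then show ?thesis unfolding cramer[OF \<open>det (A \<omega>) \<noteq> 0\<close>] .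
  qed
  moreover have "(\<lambda>\<omega>. \<chi> i j. if j = k then u \<omega> $ i else A \<omega> $ i $ j) \<in> borel_measurable M" for k
  proof (intro borel_measurable_vecI)
    show "(\<lambda>\<omega>. (\<chi> i j. if j = k then u \<omega> $ i else A \<omega> $ i $ j) $ i $ j) \<in> borel_measurable M" for i j
      by simp
  qed
  note [measurable] = borel_measurable_det[OF this] borel_measurable_det[OF assms(1)]
  ultimately show ?thesis
    unfolding inv_form_def by (simp add: inner_vec_def)
qed

lemma borel_measurable_sample_mean [measurable (raw)]:
  fixes v :: "'i::finite \<Rightarrow> 'a \<Rightarrow> 'b::euclidean_space"
  assumes [measurable]: "\<And>i. v i \<in> borel_measurable M"
  shows "(\<lambda>\<omega>. sample_mean (\<lambda>i. v i \<omega>)) \<in> borel_measurable M"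
  unfolding sample_mean_def by measurable

lemma borel_measurable_ridge_scatter [measurable (raw)]:
  fixes v :: "'i::finite \<Rightarrow> 'a \<Rightarrow> real^'p"
  assumes [measurable]: "\<And>i. v i \<in> borel_measurable M"
  shows "(\<lambda>\<omega>. ridge_scatter c (\<lambda>i. v i \<omega>)) \<in> borel_measurable M"
  by (intro borel_measurable_vecI) (simp add: ridge_scatter_def, measurable)

lemma borel_measurable_leverage [measurable (raw)]:
  fixes v :: "'i::finite \<Rightarrow> 'a \<Rightarrow> real^'p"
  assumes [measurable]: "\<And>i. v i \<in> borel_measurable M" and "c > 0"
  shows "(\<lambda>\<omega>. leverage c (\<lambda>i. v i \<omega>) j) \<in> borel_measurable M"
  unfolding leverage_def
proof (rule borel_measurable_inv_form)
  show "y = 0" if "ridge_scatter c (\<lambda>i. v i \<omega>) *v y = 0" for \<omega> y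
    using ridge_scatter_ker[OF assms(2) that] .
qed measurable

lemma borel_measurable_order_statistic:
  fixes v :: "'n::finite \<Rightarrow> 'a \<Rightarrow> real"
  assumes [measurable]: "\<And>i. v i \<in> borel_measurable M" and "1 \<le> m" "m \<le> CARD('n)"
  shows "(\<lambda>\<omega>. order_statistic m (\<lambda>i. v i \<omega>)) \<in> borel_measurable M"
  unfolding borel_measurable_iff_le order_statistic_le_iff[OF assms(2,3)]
proof
  fix t
  have "card {i. v i \<omega> \<le> t} = (\<Sum>i\<in>UNIV. if v i \<omega> \<le> t then 1 else 0)" for \<omega>
    by (simp add: sum.If_cases)
  then show "{\<omega> \<in> space M. m \<le> card {i. v i \<omega> \<le> t}} \<in> sets M"
    by simp
qed

lemma borel_measurable_stack [measurable (raw)]: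
  fixes f :: "'a \<Rightarrow> real^'k::finite" and g :: "'a \<Rightarrow> real^'l::finite"
  assumes [measurable]: "f \<in> borel_measurable M" "g \<in> borel_measurable M"
  shows "(\<lambda>\<omega>. stack (f \<omega>) (g \<omega>)) \<in> borel_measurable M"
proof (rule borel_measurable_vecI)
  fix s show "(\<lambda>\<omega>. stack (f \<omega>) (g \<omega>) $ s) \<in> borel_measurable M"
    by (cases s) (simp_all add: stack_def)
qed

section \<open>Exchangeability and coverage\<close>

text \<open>
  The conformal argument: under exchangeability an equivariant score makes every index equally likely
  to be among the \<open>m\<close> or more of small rank.
\<close>
lemma exchangeable_small_rank:
  fixes Z :: "'i::finite \<Rightarrow> 'w \<Rightarrow> 'b::topological_space"
    and score :: "('i \<Rightarrow> 'b) \<Rightarrow> 'i \<Rightarrow> real"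
  assumes "prob_space M" "exchangeable M Z"
    and Z: "\<And>i. Z i \<in> borel_measurable M"
    and score [measurable]: "\<And>j. (\<lambda>z. score z j) \<in> borel_measurable (\<Pi>\<^sub>M i\<in>UNIV. borel)"
    and equivariant: "\<And>\<pi> z j. bij \<pi> \<Longrightarrow> score (\<lambda>i. z (\<pi> i)) j = score z (\<pi> j)"
    and m: "m \<le> CARD('i)"
  defines "E \<equiv> \<lambda>j. {\<omega> \<in> space M. card {i. score (\<lambda>i. Z i \<omega>) i < score (\<lambda>i. Z i \<omega>) j} < m}"
  shows "real m / real CARD('i) \<le> measure M (E j)"
proof -
  interpret prob_space M by fact
  define P :: "('i \<Rightarrow> 'b) measure" where "P = (\<Pi>\<^sub>M i\<in>UNIV. borel)"
  define A where "A j = {z \<in> space P. card {i. score z i < score z j} < m}" for j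
  have A: "A j \<in> sets P" for j
  proof -
    have "card {i. score z i < score z j} = (\<Sum>i\<in>UNIV. if score z i < score z j then 1 else 0)" for z
      by (simp add: sum.If_cases)
    then show ?thesis unfolding A_def P_def by simp
  qed
  have Zm: "(\<lambda>\<omega> i. Z (\<pi> i) \<omega>) \<in> measurable M P" for \<pi> :: "'i \<Rightarrow> 'i"
    unfolding P_def using measurable_PiM_single'[of UNIV "\<lambda>i. Z (\<pi> i)" M "\<lambda>_. borel"] Z by simp
  have E_vimage: "E j = (\<lambda>\<omega> i. Z i \<omega>) -` A j \<inter> space M" for j
    using measurable_space[OF Zm[of id]] unfolding E_def A_def by auto
  have E: "E j \<in> sets M" for j
    unfolding E_vimage using measurable_sets[OF Zm[of id] A[of j]] by simp
  have same: "measure M (E (\<pi> j)) = measure M (E j)" if "bij \<pi>" for \<pi> j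
  proof -
    have "card {i. score z (\<pi> i) < t} = card {i. score z i < t}" for z t
      using bij_betw_same_card[of \<pi> "{i. score z (\<pi> i) < t}" "{i. score z i < t}"] that
      by (force simp: bij_betw_def bij_def inj_on_def surj_def image_iff)
    then have "(\<lambda>\<omega> i. Z (\<pi> i) \<omega>) -` A j \<inter> space M = E (\<pi> j)"
      using measurable_space[OF Zm[of \<pi>]] unfolding E_def A_def
      by (auto simp: equivariant[OF that, of "\<lambda>i. Z i _"])
    then have "measure M (E (\<pi> j)) = measure (distr M P (\<lambda>\<omega> i. Z (\<pi> i) \<omega>)) (A j)"
      by (simp add: measure_distr[OF Zm A])
    also have "distr M P (\<lambda>\<omega> i. Z (\<pi> i) \<omega>) = distr M P (\<lambda>\<omega> i. Z i \<omega>)"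
      using assms(2) that unfolding exchangeable_def P_def by blast
    also have "measure \<dots> (A j) = measure M (E j)"
      using measure_distr[OF Zm[of id] A[of j]] by (simp add: E_vimage)
    finally show ?thesis .
  qed
  \<comment> \<open>A transposition carries any index to any other, so all \<open>E k\<close> have the same probability, and
    these probabilities add up to the expected number of small ranks.\<close>
  have all: "measure M (E k) = measure M (E j)" for k
    using same[of "Transposition.transpose j k" j] by simp
  have "real m = (\<integral>\<omega>. real m \<partial>M)" by (simp add: prob_space)
  also have "\<dots> \<le> (\<integral>\<omega>. (\<Sum>k\<in>UNIV. indicator (E k) \<omega>) \<partial>M)"
  proof (rule integral_mono)
    fix \<omega> assume "\<omega> \<in> space M"
    then have "(\<Sum>k\<in>UNIV. indicator (E k) \<omega> :: real)
        = real (card {j. card {i. score (\<lambda>i. Z i \<omega>) i < score (\<lambda>i. Z i \<omega>) j} < m})"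
      by (simp add: E_def indicator_def sum.If_cases)
    then show "real m \<le> (\<Sum>k\<in>UNIV. indicator (E k) \<omega>)"
      using card_small_rank[OF m] by simp
  qed (use E in \<open>auto intro!: integrable_real_indicator simp: emeasure_eq_measure\<close>)
  also have "\<dots> = (\<Sum>k\<in>UNIV. measure M (E k))"
    using E by (subst Bochner_Integration.integral_sum)
      (auto intro!: integrable_real_indicator simp: emeasure_eq_measure)
  also have "\<dots> = (\<Sum>k\<in>(UNIV :: 'i set). measure M (E j))" by (rule sum.cong[OF refl all])
  also have "\<dots> = real CARD('i) * measure M (E j)" by simp
  finally show "real m / real CARD('i) \<le> measure M (E j)"
    by (simp add: divide_le_eq mult.commute)
qed

theorem theorem3p1:
  fixes M :: "'w measure"
    and X :: "'n::finite option \<Rightarrow> 'w \<Rightarrow> real^'k::finite"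
    and Y :: "'n option \<Rightarrow> 'w \<Rightarrow> real^'l::finite"
    and fhat :: "real^'k \<Rightarrow> real^'l"
    and lam \<alpha> :: real
  assumes "prob_space M"
    and "lam > 0"
    and "fhat \<in> borel_measurable borel"
    and "\<And>i. X i \<in> borel_measurable M"
    and "\<And>i. Y i \<in> borel_measurable M"
    and "exchangeable M (\<lambda>i \<omega>. (X i \<omega>, Y i \<omega>))"
    and "1 / (real CARD('n) + 1) < \<alpha>" and "\<alpha> < 1"
  shows "measure M {\<omega> \<in> space M.
           Y None \<omega> - fhat (X None \<omega>)
             \<in> prediction_set lam \<alpha> (\<lambda>i. X (Some i) \<omega>)
                 (\<lambda>i. Y (Some i) \<omega> - fhat (X (Some i) \<omega>)) (X None \<omega>)}
         \<ge> 1 - \<alpha>"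
proof -
  interpret prob_space M by fact
  note [measurable] = assms(3,4,5)
  define n where "n = real CARD('n)"
  \<comment> \<open>The penalty is kept at \<open>n * lam\<close>, not \<open>(n + 1) * lam\<close>, for the full sample as well: only then is
    the full scatter matrix a rank-one update of the one that defines the prediction set.\<close>
  define c where "c = n * lam"
  define m where "m = nat \<lceil>(1 - \<alpha>) * (n + 1)\<rceil>"
  define g where "g z = stack (fst z) (snd z - fhat (fst z))" for z :: "(real^'k) \<times> (real^'l)"
  define V where "V \<omega> i = g (X i \<omega>, Y i \<omega>)" for \<omega> i
  have n: "n > 0" unfolding n_def by simp
  have c: "c > 0" using n assms(2) unfolding c_def by simp
  have card_option: "real CARD('n option) = n + 1"
    unfolding n_def by (simp add: card_UNIV_option)
  have pos: "(1 - \<alpha>) * (n + 1) > 0" using n assms(8) by simp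
  have m_ge: "(1 - \<alpha>) * (n + 1) \<le> real m" unfolding m_def using pos by linarith
  have m1: "1 \<le> m" using m_ge pos by linarith
  have "1 < \<alpha> * (n + 1)" using assms(7) n unfolding n_def by (simp add: divide_less_eq)
  then have "(1 - \<alpha>) * (n + 1) < n" by (simp add: algebra_simps)
  then have mn: "m \<le> CARD('n)" unfolding m_def n_def by linarith
  have g [measurable]: "g \<in> borel_measurable borel"
    unfolding g_def borel_prod[symmetric] by measurable
  have V [measurable]: "(\<lambda>\<omega>. V \<omega> i) \<in> borel_measurable M" for i
    unfolding V_def g_def by measurable
  define E where "E = {\<omega> \<in> space M. card {i. leverage c (V \<omega>) i < leverage c (V \<omega>) None} < m}"
  define F where "F = {\<omega> \<in> space M.
           Y None \<omega> - fhat (X None \<omega>)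
             \<in> prediction_set lam \<alpha> (\<lambda>i. X (Some i) \<omega>)
                 (\<lambda>i. Y (Some i) \<omega> - fhat (X (Some i) \<omega>)) (X None \<omega>)}"
  define q where "q \<omega> = n * order_statistic m (leverage c (\<lambda>i. V \<omega> (Some i)))" for \<omega>
  define \<delta> where "\<delta> \<omega> = inv_form (ridge_scatter c (\<lambda>i. V \<omega> (Some i)))
      (V \<omega> None - sample_mean (\<lambda>i. V \<omega> (Some i)))" for \<omega>
  have q_eq: "quantile lam \<alpha> (\<lambda>i. X (Some i) \<omega>) (\<lambda>i. Y (Some i) \<omega> - fhat (X (Some i) \<omega>)) = q \<omega>" for \<omega>
    unfolding quantile_def ridge_hat_diag q_def m_def n_def c_def V_def g_def by simp
  \<comment> \<open>A nonmeasurable event would have measure \<open>0\<close>, so measurability of \<open>F\<close> is part of the claim; it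
    is read off from this description.\<close>
  have F: "F = {\<omega> \<in> space M. q \<omega> \<ge> n - 1 \<or> n * \<delta> \<omega> \<le> (q \<omega> + 1) / (1 - (q \<omega> + 1) / n) - 1}"
    unfolding F_def prediction_set_iff[OF assms(2)] q_eq
    unfolding \<delta>_def n_def c_def V_def g_def by simp
  have [measurable]: "(\<lambda>\<omega>. leverage c (\<lambda>i. V \<omega> (Some i)) j) \<in> borel_measurable M" for j
    using c by measurable
  have [measurable]: "q \<in> borel_measurable M"
    unfolding q_def using borel_measurable_order_statistic[of "\<lambda>j \<omega>. leverage c (\<lambda>i. V \<omega> (Some i)) j" M m] m1 mn
    by simp
  have [measurable]: "\<delta> \<in> borel_measurable M"
    unfolding \<delta>_def
  proof (rule borel_measurable_inv_form)
    show "y = 0" if "ridge_scatter c (\<lambda>i. V \<omega> (Some i)) *v y = 0" for \<omega> y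
      using ridge_scatter_ker[OF c that] .
  qed measurable
  have "F \<in> sets M" unfolding F by measurable
  moreover have "E \<subseteq> F"
  proof
    fix \<omega> assume "\<omega> \<in> E"
    then have \<omega>: "\<omega> \<in> space M" and rank: "card {i. leverage c (V \<omega>) i < leverage c (V \<omega>) None} < m"
      unfolding E_def by auto
    have "leverage c (V \<omega>) None \<le> q \<omega> / n + 1 / (n * (n + 1))"
      using leverage_new_le_order_statistic[OF c m1 mn rank] n unfolding q_def n_def by simp
    then have "(n / (n + 1))^2 * \<delta> \<omega> / (1 + n / (n + 1) * \<delta> \<omega>) \<le> q \<omega> / n + 1 / (n * (n + 1))"
      using leverage_new[OF c, of "V \<omega>"] unfolding \<delta>_def n_def by simp
    moreover have "\<delta> \<omega> \<ge> 0" unfolding \<delta>_def by (rule inv_form_nonneg[OF c])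
    ultimately show "\<omega> \<in> F"
      using score_le_threshold[OF n, of "\<delta> \<omega>" "q \<omega>"] \<omega>
      unfolding F by (cases "q \<omega> < n - 1") simp_all
  qed
  ultimately have "measure M E \<le> measure M F" by (intro finite_measure_mono)
  moreover have "real m / (n + 1) \<le> measure M E"
  proof -
    have eqv: "leverage c (\<lambda>i. g (z (\<pi> i))) j = leverage c (\<lambda>i. g (z i)) (\<pi> j)"
      if "bij \<pi>" for \<pi> :: "'n option \<Rightarrow> 'n option" and z j
      using leverage_permute[OF that, of c "\<lambda>i. g (z i)" j] .
    have "real m / real CARD('n option) \<le> measure M {\<omega> \<in> space M.
       card {i. leverage c (\<lambda>i. g (X i \<omega>, Y i \<omega>)) i < leverage c (\<lambda>i. g (X i \<omega>, Y i \<omega>)) None} < m}"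
    proof (rule exchangeable_small_rank[OF assms(1,6), where score = "\<lambda>z. leverage c (\<lambda>i. g (z i))"])
      show "(\<lambda>z. leverage c (\<lambda>i. g (z i)) j) \<in> borel_measurable (\<Pi>\<^sub>M i\<in>UNIV. borel)" for j
        by (rule borel_measurable_leverage[OF _ c]) measurable
      show "m \<le> CARD('n option)" using mn by (simp add: card_UNIV_option)
    qed (auto intro: eqv)
    then show ?thesis unfolding E_def V_def card_option by simp
  qed
  moreover have "1 - \<alpha> \<le> real m / (n + 1)" using m_ge n by (simp add: pos_le_divide_eq)
  ultimately show ?thesis unfolding F_def by linarith
qed

end
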